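(* Let $F,\|\cdot\|,\psi,q,\tau,L,\kappa,\mu$ satisfy the Assumption in the context, and suppose $\kappa<q$. Put $q_\ast=\frac{q}{q-1}$, $r:=\frac{q-\kappa}{\kappa}$, $M:=\left(\frac{r}{q}\right)^r$, $\beta:=q-\kappa+\frac{q-\kappa}{q}$. Let $\alpha>0$ be arbitrary and, for $t\ge 1$, set $$\alpha_t:=\big(\tau(q-\beta)\big)^{q-\kappa}\frac{\alpha}{t^{\beta}},\qquad \eta_t:=\alpha_t\Big(\frac{t}{\tau(q-\beta)}\Big)^{q-1},$$ $$C_t:=\Big(\frac{\eta_t}{\alpha_t}\Big)^{q_\ast-1}-\frac1\tau,\qquad \epsilon_t:=\frac{\alpha^{\frac{q}{q-\kappa}}}{t\,\eta_t}\,\frac{M^{1/r}}{\mu^{1/r}}\,L^{1+1/r}.$$ Then there is a constant $c>0$ depending only on $(q,\kappa)$ such that for every number of iterations $T\ge 2$, the output $x_{T+1}^{ag}$ of Algorithm 1 (see context) run with these parameters satisfies $$F(x_{T+1}^{ag})-F_\star\le c\,\frac{L\tau^q}{T^{\frac{\kappa q+\kappa-q}{q}}}\left(\frac{D_\psi(x_\star,x_1)}{\alpha L}+\Big(\frac{\alpha L}{\mu}\Big)^{\frac{\kappa}{q-\kappa}}\log T\right).$$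
   Context: For a continuously differentiable $G:\mathbb{R}^d\to\mathbb{R}$ the Bregman divergence is $D_G(x,y):=G(x)-G(y)-\langle\nabla G(y),x-y\rangle$ (convexity of $G$ is not assumed). Assumption. $\|\cdot\|$ is an arbitrary norm on $\mathbb{R}^d$; $F,\psi:\mathbb{R}^d\to\mathbb{R}$ are continuously differentiable; $q\ge2$, $1<\kappa\le2$, $\tau,L,\mu>0$; and - $F$ is $\tau$-star-convex: there exists $x_\star\in\arg\min F$ such that $\tau\langle\nabla F(x),x-x_\star\rangle\ge F(x)-F(x_\star)$ for all $x\in\mathbb{R}^d$. Write $F_\star=F(x_\star)$ for this $x_\star$. - $F$ is $(L,\kappa)$-weakly smooth with respect to $\|\cdot\|$: $|D_F(x,y)|\le\frac{L}{\kappa}\|x-y\|^\kappa$ for all $x,y$. - $\psi$ is $(\mu,q)$-uniformly convex with respect to $\|\cdot\|$: $D_\psi(x,y)\ge\frac{\mu}{q}\|x-y\|^q$ for all $x,y$. Algorithm 1 (accelerated mirror descent with binary search). Input: a starting point $x_1=x_1^{ag}\in\mathbb{R}^d$, number of iterations $T$, parameters $(C_t,\epsilon_t,\alpha_t,\eta_t)_{t\ge1}$. For $t=1,\dots,T$: 1. by binary search between the endpoints $x_t,x_t^{ag}$, find $\lambda_t\in[0,1]$ such that, with $x_t^{md}=\lambda_tx_t^{ag}+(1-\lambda_t)x_t$, one has $\langle\nabla F(x_t^{md}),x_t^{md}-x_t\rangle+C_t\big(F(x_t^{md})-F(x_t^{ag})\big)\le\epsilon_t$; 2. $x_{t+1}=\arg\min_{x\in\mathbb{R}^d}\{\eta_t\langle\nabla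 F(x_t^{md}),x\rangle+D_\psi(x,x_t)\}$; 3. $x_{t+1}^{ag}\in\arg\min_{x\in\mathbb{R}^d}\{\alpha_t\langle\nabla F(x_t^{md}),x\rangle+\frac{\mu}{q}\|x-x_t^{md}\|^q\}$ (any minimizer). Output $x_{T+1}^{ag}$. *)

theory Defs
  imports "HOL-Analysis.Analysis" "HOL-Analysis.Finite_Function_Topology"
begin

(* The constant of the theorem must not depend on the dimension d, so d has to be a bound
   variable and cannot be a type. R^d is therefore the d-dimensional coordinate subspace of
   the normed space of finitely supported real sequences. The norm of that ambient type (the
   l1-norm) only supplies the topology and the notion of Frechet derivative, for which the
   choice of norm is immaterial in finite dimension; the arbitrary norm of the setting is the parameter
   nrm below. Functions on R^d are functions on the whole type of which only the values on
   "Rd d" are ever used. *)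

type_synonym rvec = "nat \<Rightarrow>\<^sub>0 real"

definition Rd :: "nat \<Rightarrow> rvec set" where
  "Rd d = {x. Poly_Mapping.keys x \<subseteq> {..<d}}"

(* The coordinates outside the support of x contribute 0, so on "Rd d" this is the sum over
   i < d; see dot_eq_sum. *)
definition dot :: "rvec \<Rightarrow> rvec \<Rightarrow> real" where
  "dot x y = (\<Sum>i\<in>Poly_Mapping.keys x. Poly_Mapping.lookup x i * Poly_Mapping.lookup y i)"

definition norm_on_Rd :: "nat \<Rightarrow> (rvec \<Rightarrow> real) \<Rightarrow> bool" where
  "norm_on_Rd d nrm \<longleftrightarrow>
     (\<forall>x\<in>Rd d. 0 \<le> nrm x) \<and>
     (\<forall>x\<in>Rd d. nrm x = 0 \<longleftrightarrow> x = 0) \<and>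
     (\<forall>a. \<forall>x\<in>Rd d. nrm (a *\<^sub>R x) = \<bar>a\<bar> * nrm x) \<and>
     (\<forall>x\<in>Rd d. \<forall>y\<in>Rd d. nrm (x + y) \<le> nrm x + nrm y)"

definition has_gradient :: "nat \<Rightarrow> (rvec \<Rightarrow> real) \<Rightarrow> rvec \<Rightarrow> rvec \<Rightarrow> bool" where
  "has_gradient d G g x \<longleftrightarrow> g \<in> Rd d \<and> (G has_derivative (\<lambda>h. dot g h)) (at x within Rd d)"

definition grad :: "nat \<Rightarrow> (rvec \<Rightarrow> real) \<Rightarrow> rvec \<Rightarrow> rvec" where
  "grad d G x = (THE g. has_gradient d G g x)"

definition cont_diff :: "nat \<Rightarrow> (rvec \<Rightarrow> real) \<Rightarrow> bool" where
  "cont_diff d G \<longleftrightarrow>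
     (\<forall>x\<in>Rd d. \<exists>g. has_gradient d G g x) \<and> continuous_on (Rd d) (grad d G)"

definition bregman :: "nat \<Rightarrow> (rvec \<Rightarrow> real) \<Rightarrow> rvec \<Rightarrow> rvec \<Rightarrow> real" where
  "bregman d G x y = G x - G y - dot (grad d G y) (x - y)"

(* xs is the minimiser with respect to which F is star-convex. *)
definition star_convex_at :: "nat \<Rightarrow> real \<Rightarrow> (rvec \<Rightarrow> real) \<Rightarrow> rvec \<Rightarrow> bool" where
  "star_convex_at d \<tau> F xs \<longleftrightarrow>
     is_arg_min F (\<lambda>x. x \<in> Rd d) xs \<and>
     (\<forall>x\<in>Rd d. \<tau> * dot (grad d F x) (x - xs) \<ge> F x - F xs)"

definition weakly_smooth :: "nat \<Rightarrow> (rvec \<Rightarrow> real) \<Rightarrow> real \<Rightarrow> real \<Rightarrow> (rvec \<Rightarrow> real) \<Rightarrow> bool" where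
  "weakly_smooth d nrm L \<kappa> F \<longleftrightarrow>
     (\<forall>x\<in>Rd d. \<forall>y\<in>Rd d. \<bar>bregman d F x y\<bar> \<le> L / \<kappa> * nrm (x - y) powr \<kappa>)"

definition unif_convex :: "nat \<Rightarrow> (rvec \<Rightarrow> real) \<Rightarrow> real \<Rightarrow> real \<Rightarrow> (rvec \<Rightarrow> real) \<Rightarrow> bool" where
  "unif_convex d nrm \<mu> q \<psi> \<longleftrightarrow>
     (\<forall>x\<in>Rd d. \<forall>y\<in>Rd d. bregman d \<psi> x y \<ge> \<mu> / q * nrm (x - y) powr q)"

(* T iterations of accelerated mirror descent with parameter sequences C, eps, alpha, eta,
   as a relation on the iterates x, xag, xmd and the weights lam. The binary search enters
   only through its specification: lam t is any weight in [0,1] meeting the stopping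
   criterion. Likewise xag (t+1) is any minimiser in its step; the minimiser defining
   x (t+1) is unique when psi is uniformly convex. *)
definition amd_run ::
  "nat \<Rightarrow> (rvec \<Rightarrow> real) \<Rightarrow> (rvec \<Rightarrow> real) \<Rightarrow> (rvec \<Rightarrow> real) \<Rightarrow> real \<Rightarrow> real \<Rightarrow>
   (nat \<Rightarrow> real) \<Rightarrow> (nat \<Rightarrow> real) \<Rightarrow> (nat \<Rightarrow> real) \<Rightarrow> (nat \<Rightarrow> real) \<Rightarrow> nat \<Rightarrow>
   (nat \<Rightarrow> rvec) \<Rightarrow> (nat \<Rightarrow> rvec) \<Rightarrow> (nat \<Rightarrow> rvec) \<Rightarrow> (nat \<Rightarrow> real) \<Rightarrow> bool" where
  "amd_run d nrm F \<psi> \<mu> q C \<epsilon> \<alpha> \<eta> T x xag xmd lam \<longleftrightarrow>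
     x 1 \<in> Rd d \<and> xag 1 = x 1 \<and>
     (\<forall>t\<in>{1..T}.
        0 \<le> lam t \<and> lam t \<le> 1 \<and>
        xmd t = lam t *\<^sub>R xag t + (1 - lam t) *\<^sub>R x t \<and>
        dot (grad d F (xmd t)) (xmd t - x t) + C t * (F (xmd t) - F (xag t)) \<le> \<epsilon> t \<and>
        is_arg_min (\<lambda>y. \<eta> t * dot (grad d F (xmd t)) y + bregman d \<psi> y (x t))
          (\<lambda>y. y \<in> Rd d) (x (t + 1)) \<and>
        is_arg_min (\<lambda>y. \<alpha> t * dot (grad d F (xmd t)) y + \<mu> / q * nrm (y - xmd t) powr q)
          (\<lambda>y. y \<in> Rd d) (xag (t + 1)))"

lemma dot_eq_sum:
  assumes "x \<in> Rd d"
  shows "dot x y = (\<Sum>i<d. Poly_Mapping.lookup x i * Poly_Mapping.lookup y i)"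
  unfolding dot_def
  by (rule sum.mono_neutral_left) (use assms in \<open>auto simp: Rd_def in_keys_iff\<close>)

lemma lookup_scaleR_rvec:
  "Poly_Mapping.lookup (a *\<^sub>R (x::rvec)) i = a * Poly_Mapping.lookup x i"
proof -
  have "finite {i. a * Poly_Mapping.lookup x i \<noteq> 0}"
    by (rule finite_subset[OF _ finite_lookup[of x]]) auto
  then show ?thesis
    by (simp add: scaleR_poly_mapping_def)
qed

lemma has_gradient_unique:
  assumes "x \<in> Rd d" "has_gradient d G g x" "has_gradient d G g' x"
  shows "g = g'"
proof (rule poly_mapping_eqI)
  fix i
  have g: "g \<in> Rd d" "g' \<in> Rd d"
    using assms by (auto simp: has_gradient_def)
  show "Poly_Mapping.lookup g i = Poly_Mapping.lookup g' i"
  proof (cases "i < d")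
    case False
    then have "i \<notin> Poly_Mapping.keys g" "i \<notin> Poly_Mapping.keys g'"
      using g by (auto simp: Rd_def)
    then show ?thesis by (simp add: in_keys_iff)
  next
    case True
    define e :: rvec where "e = Poly_Mapping.single i 1"
    have look: "Poly_Mapping.lookup (x + t *\<^sub>R e) j = Poly_Mapping.lookup x j + t * (1 when i = j)"
      for t j
      by (simp add: lookup_add lookup_scaleR_rvec e_def lookup_single)
    have line: "x + t *\<^sub>R e \<in> Rd d" for t
    proof -
      have "Poly_Mapping.lookup (x + t *\<^sub>R e) j = 0" if "\<not> j < d" for j
      proof -
        have "Poly_Mapping.lookup x j = 0"
          using assms(1) that by (auto simp: Rd_def in_keys_iff)
        then show ?thesis using that True look[of t j] by auto
      qed
      then show ?thesis unfolding Rd_def by (auto simp: in_keys_iff)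
    qed
    have doti: "dot u (t *\<^sub>R e) = t * Poly_Mapping.lookup u i" if "u \<in> Rd d" for u t
      using True by (simp add: dot_eq_sum[OF that] lookup_scaleR_rvec e_def lookup_single when_def if_distrib cong: if_cong)
    have der: "((\<lambda>t. G (x + t *\<^sub>R e)) has_derivative (\<lambda>t. dot u (t *\<^sub>R e))) (at 0)"
      if "has_gradient d G u x" for u
    proof -
      have 1: "((\<lambda>t. x + t *\<^sub>R e) has_derivative (\<lambda>t. t *\<^sub>R e)) (at 0)"
        by (auto intro!: derivative_eq_intros)
      have 2: "(G has_derivative dot u) (at (x + 0 *\<^sub>R e) within range (\<lambda>t. x + t *\<^sub>R e))"
        using that line by (auto simp: has_gradient_def intro: has_derivative_subset)
      show ?thesis
        using has_derivative_in_compose[OF 1, of G "dot u"] 2 by simp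
    qed
    have "(\<lambda>t. dot g (t *\<^sub>R e)) = (\<lambda>t. dot g' (t *\<^sub>R e))"
      by (rule has_derivative_unique[OF der[OF assms(2)] der[OF assms(3)]])
    then show ?thesis
      using doti[OF g(1), of 1] doti[OF g(2), of 1] by (metis mult_1)
  qed
qed

lemma grad_eq:
  assumes "x \<in> Rd d" "has_gradient d G g x"
  shows "grad d G x = g"
  unfolding grad_def using assms has_gradient_unique by blast

end

theory Submission
  imports Defs "HOL-Analysis.Harmonic_Numbers"
begin

text \<open>
  Let \<open>\<delta>\<^sub>t = F(x\<^sub>t\<^sup>a\<^sup>g) - F(x\<^sub>\<star>)\<close>, \<open>D\<^sub>t = D\<^sub>\<psi>(x\<^sub>\<star>, x\<^sub>t)\<close> and \<open>p = q - \<beta> = (\<kappa> q + \<kappa> - q)/q\<close>. One iteration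
  (\<open>amd_one_step\<close>) combines the optimality of the mirror step, which produces \<open>D\<^sub>t - D\<^sub>t\<^sub>+\<^sub>1\<close>, the
  descent step from \<open>x\<^sub>t\<^sup>m\<^sup>d\<close>, star-convexity and the stopping rule of the search. The mirror step is
  compared with the descent step by rescaling its displacement (\<open>prox_value_scaling\<close>), which makes
  the argument independent of the norm. With the prescribed parameters and
  \<open>A = \<alpha>/(\<tau> p)\<^sup>\<kappa>\<close>, the result is
  \<open>A t\<^sup>p \<delta>\<^sub>t\<^sub>+\<^sub>1 - A t\<^sup>p (1 - p/t) \<delta>\<^sub>t \<le> D\<^sub>t - D\<^sub>t\<^sub>+\<^sub>1 + 2 K/t\<close>,
  where \<open>K = c \<alpha> L V\<close> with \<open>c = (q - \<kappa>)/(q \<kappa>) < 1\<close>, and \<open>V\<close> is the power of \<open>\<alpha> L/\<mu>\<close> in the rate.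

  Summation gives a bound on \<open>A T\<^sup>p \<delta>\<^sub>T\<^sub>+\<^sub>1\<close> by \<open>D\<^sub>1\<close> and \<open>K log T\<close>, but two points need care. First,
  \<open>p\<close> can be smaller than \<open>1\<close>, and then \<open>t\<^sup>p (1 - p/t)\<close> exceeds \<open>(t - 1)\<^sup>p\<close> and the sum does not
  telescope. Slowly decreasing weights between \<open>1\<close> and \<open>1/2\<close> restore the telescoping
  (\<open>weighted_recursion_bound\<close>), at the cost of a factor \<open>2\<close> and of the initial gap \<open>\<delta>\<^sub>1\<close>, which
  \<open>initial_gap_bound\<close> estimates by the two terms of the rate. Second, the argument yields the
  factors \<open>\<tau>\<^sup>\<kappa>\<close> and \<open>1\<close> instead of \<open>\<tau>\<^sup>q\<close>, so \<open>\<tau>\<close> has to be bounded below: a function that is not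
  constant and grows at most like the power \<open>\<kappa>\<close> has \<open>\<tau> \<ge> 1/\<kappa> \<ge> 1/2\<close>
  (\<open>star_convexity_parameter_ge\<close>), and if the final gap is zero nothing is left to prove. The
  constant \<open>16 * 2\<^sup>q\<close> results.
\<close>

section \<open>The coordinate subspace and gradients on it\<close>

lemma add_in_Rd:
  assumes "x \<in> Rd d" "y \<in> Rd d"
  shows "x + y \<in> Rd d"
  using assms Poly_Mapping.keys_add[of x y] by (auto simp: Rd_def)

lemma scaleR_in_Rd:
  assumes "x \<in> Rd d"
  shows "a *\<^sub>R x \<in> Rd d"
  using assms by (auto simp: Rd_def in_keys_iff lookup_scaleR_rvec)

lemma diff_in_Rd:
  assumes "x \<in> Rd d" "y \<in> Rd d"
  shows "x - y \<in> Rd d"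
  using add_in_Rd[OF assms(1) scaleR_in_Rd[OF assms(2), of "-1"]] by simp

lemmas in_Rd = add_in_Rd scaleR_in_Rd diff_in_Rd

lemma dot_add_right: "dot g (x + y) = dot g x + dot g y"
  by (simp add: dot_def lookup_add algebra_simps sum.distrib)

lemma dot_scaleR_right: "dot g (a *\<^sub>R x) = a * dot g x"
  by (simp add: dot_def lookup_scaleR_rvec sum_distrib_left algebra_simps)

lemma dot_diff_right: "dot g (x - y) = dot g x - dot g y"
  by (simp add: dot_def lookup_minus algebra_simps sum_subtractf)

lemmas dot_simps = dot_add_right dot_scaleR_right dot_diff_right

lemma has_gradient_grad:
  assumes "cont_diff d G" "x \<in> Rd d"
  shows "has_gradient d G (grad d G x) x"
  using assms by (metis cont_diff_def grad_eq)

lemma grad_in_Rd: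
  assumes "cont_diff d G" "x \<in> Rd d"
  shows "grad d G x \<in> Rd d"
  using has_gradient_grad[OF assms] by (simp add: has_gradient_def)

lemma DERIV_along_line:
  assumes "cont_diff d G" "x \<in> Rd d" "h \<in> Rd d"
  shows "((\<lambda>s. G (x + s *\<^sub>R h)) has_real_derivative dot (grad d G (x + s0 *\<^sub>R h)) h) (at s0)"
proof -
  have line: "x + s *\<^sub>R h \<in> Rd d" for s
    using assms by (intro in_Rd)
  have 1: "((\<lambda>s. x + s *\<^sub>R h) has_derivative (\<lambda>s. s *\<^sub>R h)) (at s0)"
    by (auto intro!: derivative_eq_intros)
  have 2: "(G has_derivative dot (grad d G (x + s0 *\<^sub>R h)))
      (at (x + s0 *\<^sub>R h) within range (\<lambda>s. x + s *\<^sub>R h))"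
    using has_gradient_grad[OF assms(1) line] line
    by (auto simp: has_gradient_def intro: has_derivative_subset)
  have "((\<lambda>s. G (x + s *\<^sub>R h)) has_derivative
      (\<lambda>s. dot (grad d G (x + s0 *\<^sub>R h)) (s *\<^sub>R h))) (at s0)"
    using has_derivative_in_compose[OF 1 2] by simp
  then show ?thesis
    by (simp add: has_field_derivative_def dot_scaleR_right mult.commute[of _ "dot _ _"])
qed

text \<open>
  First-order optimality of a linear perturbation of \<open>G\<close>: along every line through the
  minimiser the objective is a differentiable function of one real variable with an interior
  minimum.
\<close>

lemma dot_grad_argmin:
  assumes "cont_diff d G" "is_arg_min (\<lambda>y. dot c y + G y) (\<lambda>y. y \<in> Rd d) z" "h \<in> Rd d"
  shows "dot c h + dot (grad d G z) h = 0"
proof -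
  have z: "z \<in> Rd d" and min: "\<And>y. y \<in> Rd d \<Longrightarrow> dot c z + G z \<le> dot c y + G y"
    using assms(2) by (auto simp: is_arg_min_linorder)
  let ?f = "\<lambda>s. dot c (z + s *\<^sub>R h) + G (z + s *\<^sub>R h)"
  have "(?f has_real_derivative (dot c h + dot (grad d G z) h)) (at 0)"
    unfolding dot_simps
    by (rule derivative_eq_intros DERIV_along_line[OF assms(1) z assms(3), of 0, simplified] refl | simp)+
  moreover have "\<forall>s. \<bar>0 - s\<bar> < 1 \<longrightarrow> ?f 0 \<le> ?f s"
    using min[OF add_in_Rd[OF z scaleR_in_Rd[OF assms(3)]]] by simp
  ultimately show ?thesis
    using DERIV_local_min[of ?f _ 0 1] by simp
qed

lemma grad_eq_0_at_argmin:
  assumes "cont_diff d G" "is_arg_min G (\<lambda>y. y \<in> Rd d) z" "h \<in> Rd d"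
  shows "dot (grad d G z) h = 0"
  using dot_grad_argmin[OF assms(1) _ assms(3), of 0 z] assms(2) by (simp add: dot_def)

lemma dot_scaleR_left: "dot (a *\<^sub>R x) y = a * dot x y"
proof -
  obtain d where "x \<in> Rd d"
  proof -
    have "Poly_Mapping.keys x \<subseteq> {..<Suc (Max (Poly_Mapping.keys x))}"
      by (auto simp: less_Suc_eq_le)
    then show ?thesis using that by (auto simp: Rd_def)
  qed
  then show ?thesis
    using scaleR_in_Rd[of x d a]
    by (simp add: dot_eq_sum lookup_scaleR_rvec sum_distrib_left mult.assoc)
qed

lemma dot_diff_left:
  assumes "x \<in> Rd d" "y \<in> Rd d"
  shows "dot (x - y) z = dot x z - dot y z"
  using assms diff_in_Rd[OF assms]
  by (simp add: dot_eq_sum lookup_minus sum_subtractf algebra_simps)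

section \<open>One iteration\<close>

text \<open>
  The optimality condition of the mirror step is \<open>\<eta> g = \<nabla>\<psi>(x) - \<nabla>\<psi>(x')\<close>. Paired with
  \<open>x' - z\<close>, its right-hand side is a combination of three Bregman divergences, and the first two
  telescope along the iteration when \<open>z\<close> is kept fixed.
\<close>

lemma mirror_step_three_point:
  assumes "cont_diff d \<psi>" "x \<in> Rd d" "z \<in> Rd d" "g \<in> Rd d"
    and "is_arg_min (\<lambda>y. \<eta> * dot g y + bregman d \<psi> y x) (\<lambda>y. y \<in> Rd d) x'"
  shows "\<eta> * dot g (x' - z) = bregman d \<psi> z x - bregman d \<psi> z x' - bregman d \<psi> x' x"
proof -
  let ?c = "\<eta> *\<^sub>R g - grad d \<psi> x"
  have x': "x' \<in> Rd d" using assms(5) by (simp add: is_arg_min_def)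
  have c: "dot ?c y = \<eta> * dot g y - dot (grad d \<psi> x) y" for y
    using dot_diff_left[OF scaleR_in_Rd[OF assms(4)] grad_in_Rd[OF assms(1,2)]]
    by (simp add: dot_scaleR_left)
  have "is_arg_min (\<lambda>y. dot ?c y + \<psi> y) (\<lambda>y. y \<in> Rd d) x'"
    using assms(5) by (simp add: is_arg_min_linorder c bregman_def dot_simps algebra_simps)
  then have "dot ?c (x' - z) + dot (grad d \<psi> x') (x' - z) = 0"
    using dot_grad_argmin[OF assms(1) _ diff_in_Rd[OF x' assms(3)]] by blast
  then show ?thesis
    by (simp add: c bregman_def dot_simps algebra_simps)
qed

lemma norm_on_Rd_scaleR:
  assumes "norm_on_Rd d nrm" "x \<in> Rd d"
  shows "nrm (a *\<^sub>R x) = \<bar>a\<bar> * nrm x"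
  using assms unfolding norm_on_Rd_def by blast

lemma norm_on_Rd_nonneg:
  assumes "norm_on_Rd d nrm" "x \<in> Rd d"
  shows "0 \<le> nrm x"
  using assms by (simp add: norm_on_Rd_def)

lemma norm_on_Rd_minus_commute:
  assumes "norm_on_Rd d nrm" "x \<in> Rd d" "y \<in> Rd d"
  shows "nrm (x - y) = nrm (y - x)"
  using norm_on_Rd_scaleR[OF assms(1) diff_in_Rd[OF assms(3,2)], of "-1"] by simp

text \<open>
  With \<open>w = u/s\<close>, the left-hand side is \<open>s\<^sup>q (a \<langle>g, w\<rangle> - \<mu>/q \<parallel>w\<parallel>\<^sup>q)\<close> by homogeneity, and up to sign and
  the constant \<open>a \<langle>g, z\<rangle>\<close> the factor in parentheses is the objective of \<open>z'\<close> at the competitor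
  \<open>z - w\<close>. So what a mirror step of length \<open>a s\<^sup>q\<^sup>-\<^sup>1\<close> can lose is controlled by what the
  descent step of length \<open>a\<close> from another point gains, and no dual norm has to enter.
\<close>

lemma prox_value_scaling:
  assumes "norm_on_Rd d nrm" "u \<in> Rd d" "z \<in> Rd d" "0 < s"
    and "is_arg_min (\<lambda>y. a * dot g y + \<mu> / q * nrm (y - z) powr q) (\<lambda>y. y \<in> Rd d) z'"
  shows "a * s powr (q - 1) * dot g u - \<mu> / q * nrm u powr q
    \<le> s powr q * (a * dot g (z - z') - \<mu> / q * nrm (z' - z) powr q)"
proof -
  define v where "v = (- (1 / s)) *\<^sub>R u"
  have "nrm v = nrm u / s"
    using norm_on_Rd_scaleR[OF assms(1,2), of "- (1 / s)"] assms(4) by (simp add: v_def)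
  moreover have "0 \<le> nrm u" by (rule norm_on_Rd_nonneg[OF assms(1,2)])
  ultimately have v: "nrm v powr q = nrm u powr q / s powr q"
    using assms(4) by (simp add: powr_divide)
  have sq: "s powr (q - 1) = s powr q / s" using assms(4) by (simp add: powr_diff)
  have dv: "dot g v = - (dot g u / s)" by (simp add: v_def dot_scaleR_right del: scaleR_minus_left)
  have zv: "z + v \<in> Rd d" unfolding v_def by (rule add_in_Rd[OF assms(3) scaleR_in_Rd[OF assms(2)]])
  have "a * dot g z' + \<mu> / q * nrm (z' - z) powr q
      \<le> a * dot g (z + v) + \<mu> / q * nrm ((z + v) - z) powr q"
    using assms(5) zv unfolding is_arg_min_linorder by blast
  then have "a * dot g z' + \<mu> / q * nrm (z' - z) powr q
      \<le> a * (dot g z - dot g u / s) + \<mu> / q * (nrm u powr q / s powr q)"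
    by (simp only: add_diff_cancel_left' v dot_add_right dv) simp
  then have "a * (dot g u / s) - \<mu> / q * (nrm u powr q / s powr q)
      \<le> a * dot g (z - z') - \<mu> / q * nrm (z' - z) powr q"
    unfolding dot_diff_right right_diff_distrib by linarith
  then have "s powr q * (a * (dot g u / s) - \<mu> / q * (nrm u powr q / s powr q))
      \<le> s powr q * (a * dot g (z - z') - \<mu> / q * nrm (z' - z) powr q)"
    by (rule mult_left_mono) simp
  moreover have "s powr q * (a * (dot g u / s) - \<mu> / q * (nrm u powr q / s powr q))
      = a * s powr (q - 1) * dot g u - \<mu> / q * nrm u powr q"
    using assms(4) by (simp add: sq right_diff_distrib)
  ultimately show ?thesis by (simp only:)
qed

text \<open>
  Weighted arithmetic-geometric mean with weights \<open>\<kappa>/q\<close> and \<open>(q - \<kappa>)/q\<close>; the bound is the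
  maximum of the left-hand side over \<open>w\<close>, attained at the positive solution of
  \<open>a w\<^sup>\<kappa> = \<mu> w\<^sup>q\<close>.
\<close>

lemma young_power_gap:
  fixes a \<mu> q \<kappa> w :: real
  assumes "0 < \<kappa>" "\<kappa> < q" "0 < a" "0 < \<mu>" "0 \<le> w"
  shows "a / \<kappa> * w powr \<kappa> - \<mu> / q * w powr q
    \<le> (q - \<kappa>) / (q * \<kappa>) * (a powr (q / (q - \<kappa>)) / \<mu> powr (\<kappa> / (q - \<kappa>)))"
proof (cases "w = 0")
  case True
  then show ?thesis using assms by simp
next
  case False
  then have w: "0 < w" using assms by simp
  let ?b = "a powr (q / (q - \<kappa>)) / \<mu> powr (\<kappa> / (q - \<kappa>))"
  have "(\<mu> * w powr q) powr (\<kappa> / q) * ?b powr ((q - \<kappa>) / q)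
      \<le> \<kappa> / q * (\<mu> * w powr q) + (q - \<kappa>) / q * ?b"
    using assms w by (intro Youngs_inequality_0) (auto simp: diff_divide_distrib)
  moreover have "(\<mu> * w powr q) powr (\<kappa> / q) * ?b powr ((q - \<kappa>) / q) = a * w powr \<kappa>"
  proof -
    have "(\<mu> * w powr q) powr (\<kappa> / q) = \<mu> powr (\<kappa> / q) * w powr \<kappa>"
      using assms w by (simp add: powr_mult powr_powr)
    moreover have "?b powr ((q - \<kappa>) / q) = a / \<mu> powr (\<kappa> / q)"
      using assms by (simp add: powr_divide powr_powr)
    ultimately show ?thesis using assms by simp
  qed
  ultimately have "a * w powr \<kappa> / \<kappa> \<le> (\<kappa> / q * (\<mu> * w powr q) + (q - \<kappa>) / q * ?b) / \<kappa>"
    using assms by (simp add: divide_right_mono)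
  also have "\<dots> = \<mu> / q * w powr q + (q - \<kappa>) / (q * \<kappa>) * ?b"
    using assms by (simp add: add_divide_distrib)
  finally show ?thesis by simp
qed

text \<open>
  One iteration with step sizes \<open>a\<close> and \<open>\<eta> = a s\<^sup>q\<^sup>-\<^sup>1\<close>. Let \<open>g\<close> be the gradient at \<open>md\<close>. The
  mirror step bounds \<open>\<eta> \<langle>g, x - xs\<rangle>\<close> by a difference of divergences plus the scaled gain of the
  descent step from \<open>md\<close>; weak smoothness turns that gain into the decrease \<open>F(md) - F(ag')\<close> up
  to the error of Young's inequality. Star-convexity and the search criterion bound
  \<open>\<langle>g, x - xs\<rangle>\<close> from below, and the value \<open>s - 1/\<tau>\<close> of the search weight is exactly the one for
  which \<open>F(md)\<close> cancels.
\<close>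

lemma amd_one_step:
  fixes \<kappa> q \<tau> L \<mu> a s :: real
  assumes nrm: "norm_on_Rd d nrm" and F: "cont_diff d F" and \<psi>: "cont_diff d \<psi>"
    and star: "star_convex_at d \<tau> F xs" and smooth: "weakly_smooth d nrm L \<kappa> F"
    and convex: "unif_convex d nrm \<mu> q \<psi>"
    and pos: "0 < \<tau>" "0 < L" "0 < \<mu>" "1 < \<kappa>" "\<kappa> < q" "0 < a" "0 < s"
    and mem: "x \<in> Rd d" "md \<in> Rd d"
    and search: "dot (grad d F md) (md - x) + (s - 1 / \<tau>) * (F md - F ag) \<le> \<epsilon>"
    and mirror: "is_arg_min (\<lambda>y. a * s powr (q - 1) * dot (grad d F md) y + bregman d \<psi> y x)
      (\<lambda>y. y \<in> Rd d) x'"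
    and prox: "is_arg_min (\<lambda>y. a * dot (grad d F md) y + \<mu> / q * nrm (y - md) powr q)
      (\<lambda>y. y \<in> Rd d) ag'"
  shows "a * s powr q * (F ag' - F xs) - a * s powr (q - 1) * (s - 1 / \<tau>) * (F ag - F xs)
    \<le> a * s powr (q - 1) * \<epsilon> + (bregman d \<psi> xs x - bregman d \<psi> xs x')
      + s powr q * ((q - \<kappa>) / (q * \<kappa>) * ((a * L) powr (q / (q - \<kappa>)) / \<mu> powr (\<kappa> / (q - \<kappa>))))"
proof -
  let ?g = "grad d F md" and ?h = "a * s powr (q - 1)"
  define E where "E = (q - \<kappa>) / (q * \<kappa>) * ((a * L) powr (q / (q - \<kappa>)) / \<mu> powr (\<kappa> / (q - \<kappa>)))"
  have xs: "xs \<in> Rd d" using star by (simp add: star_convex_at_def is_arg_min_def)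
  have x': "x' \<in> Rd d" and ag': "ag' \<in> Rd d" using mirror prox by (simp_all add: is_arg_min_def)
  have h: "0 < ?h" using pos by simp
  have hs: "?h * s = a * s powr q" using pos by (simp add: powr_diff)
  have "F ag' - F md - dot ?g (ag' - md) \<le> L / \<kappa> * nrm (ag' - md) powr \<kappa>"
    using smooth ag' mem by (auto simp: weakly_smooth_def bregman_def abs_le_iff)
  then have "a * dot ?g (md - ag') \<le> a * (F md - F ag' + L / \<kappa> * nrm (ag' - md) powr \<kappa>)"
    using pos by (intro mult_left_mono) (auto simp: dot_simps)
  moreover have "a * L / \<kappa> * nrm (ag' - md) powr \<kappa> - \<mu> / q * nrm (ag' - md) powr q \<le> E"
    using pos norm_on_Rd_nonneg[OF nrm diff_in_Rd[OF ag' mem(2)]] unfolding E_def by (intro young_power_gap) auto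
  ultimately have "a * dot ?g (md - ag') - \<mu> / q * nrm (ag' - md) powr q \<le> a * (F md - F ag') + E"
    by (simp add: algebra_simps)
  then have "s powr q * (a * dot ?g (md - ag') - \<mu> / q * nrm (ag' - md) powr q)
      \<le> s powr q * (a * (F md - F ag') + E)"
    by (rule mult_left_mono) simp
  with prox_value_scaling[OF nrm diff_in_Rd[OF mem(1) x'] mem(2) pos(7) prox]
  have gain: "?h * dot ?g (x - x') - \<mu> / q * nrm (x - x') powr q \<le> s powr q * (a * (F md - F ag') + E)"
    by linarith
  have "\<mu> / q * nrm (x - x') powr q \<le> bregman d \<psi> x' x"
    using convex x' mem(1) norm_on_Rd_minus_commute[OF nrm mem(1) x'] by (simp add: unif_convex_def)
  with gain mirror_step_three_point[OF \<psi> mem(1) xs grad_in_Rd[OF F mem(2)] mirror]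
  have regret: "?h * dot ?g (x - xs) \<le> bregman d \<psi> xs x - bregman d \<psi> xs x'
      + s powr q * (a * (F md - F ag') + E)"
    by (simp add: dot_simps algebra_simps)
  have "(F md - F xs) / \<tau> \<le> dot ?g (md - xs)"
    using star mem pos by (simp add: star_convex_at_def field_simps)
  with search have "(F md - F xs) / \<tau> + (s - 1 / \<tau>) * (F md - F ag) - \<epsilon> \<le> dot ?g (x - xs)"
    by (simp add: dot_simps)
  then have "?h * ((F md - F xs) / \<tau> + (s - 1 / \<tau>) * (F md - F ag) - \<epsilon>) \<le> ?h * dot ?g (x - xs)"
    using h by (intro mult_left_mono) auto
  also have "?h * ((F md - F xs) / \<tau> + (s - 1 / \<tau>) * (F md - F ag) - \<epsilon>)
      = ?h * s * (F md - F xs) - ?h * (s - 1 / \<tau>) * (F ag - F xs) - ?h * \<epsilon>"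
    by (simp add: algebra_simps add_divide_distrib diff_divide_distrib)
  finally have "a * s powr q * (F md - F xs) - ?h * (s - 1 / \<tau>) * (F ag - F xs) - ?h * \<epsilon>
      \<le> ?h * dot ?g (x - xs)"
    by (simp only: hs)
  moreover have "s powr q * (a * (F md - F ag') + E)
      = a * s powr q * (F md - F xs) - a * s powr q * (F ag' - F xs) + s powr q * E"
    by (simp add: algebra_simps)
  ultimately show ?thesis using regret unfolding E_def by linarith
qed

section \<open>The scalar recursion\<close>

text \<open>
  For \<open>p \<ge> 1\<close> Bernoulli's inequality \<open>1 - p x \<le> (1 - x)\<^sup>p\<close> already suffices. For \<open>p < 1\<close> that
  inequality is reversed, with a defect of second order in \<open>x\<close>, which the factor \<open>1 - x\<^sup>2\<close>
  absorbs.
\<close>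

lemma weight_inequality:
  fixes x p :: real
  assumes "0 \<le> x" "x < 1" "0 < p"
  shows "(1 - x\<^sup>2) * (1 - p * x) \<le> (1 - x) powr p"
proof (cases "p < 1")
  case True
  have "(1 + x) * (1 - p * x) \<le> 1 + (1 - p) * x"
    using assms by (simp add: algebra_simps)
  also have "\<dots> \<le> exp ((1 - p) * x)" by (rule exp_ge_add_one_self)
  also have "\<dots> \<le> exp ((p - 1) * ln (1 - x))"
  proof -
    have "ln (1 - x) \<le> - x" using ln_le_minus_one[of "1 - x"] assms by simp
    then have "(p - 1) * (- x) \<le> (p - 1) * ln (1 - x)" using True by (intro mult_left_mono_neg) auto
    then show ?thesis by (simp add: algebra_simps)
  qed
  also have "\<dots> = (1 - x) powr (p - 1)" using assms by (simp add: powr_def)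
  finally have "(1 - x) * ((1 + x) * (1 - p * x)) \<le> (1 - x) * (1 - x) powr (p - 1)"
    using assms by (intro mult_left_mono) auto
  moreover have "(1 - x) * (1 - x) powr (p - 1) = (1 - x) powr p"
    using assms by (simp add: powr_diff)
  ultimately show ?thesis by (simp add: power2_eq_square algebra_simps)
next
  case False
  show ?thesis
  proof (cases "1 - p * x \<ge> 0")
    case True
    have "(1 - x\<^sup>2) * (1 - p * x) \<le> 1 * (1 - p * x)"
      using True by (intro mult_right_mono) auto
    also have "\<dots> \<le> (1 - x) powr p"
    proof (cases "1 - p * x = 0")
      case nz: False
      \<comment> \<open>Bernoulli's inequality with real exponent, as a weighted mean of \<open>1 - p x\<close> and \<open>1\<close>\<close>
      have "(1 - p * x) powr (1 / p) * 1 powr (1 - 1 / p) \<le> 1 / p * (1 - p * x) + (1 - 1 / p) * 1"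
        using nz True False by (intro Youngs_inequality_0) auto
      then have "(1 - p * x) powr (1 / p) \<le> 1 - x"
        using \<open>0 < p\<close> by (simp add: algebra_simps)
      then have "((1 - p * x) powr (1 / p)) powr p \<le> (1 - x) powr p"
        using \<open>0 < p\<close> by (intro powr_mono2) auto
      then show ?thesis using True \<open>0 < p\<close> by (simp add: powr_powr)
    qed simp
    finally show ?thesis .
  next
    case False
    have "x\<^sup>2 \<le> 1" using assms by (simp add: power_le_one)
    then have "(1 - x\<^sup>2) * (1 - p * x) \<le> 0"
      using False by (intro mult_nonneg_nonpos) auto
    then show ?thesis using powr_ge_zero[of "1 - x" p] by linarith
  qed
qed

text \<open>
  The recursion would telescope if \<open>t\<^sup>p (1 - p/t) \<le> (t - 1)\<^sup>p\<close>, which is false for \<open>p < 1\<close>.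
  Multiplication with the weights \<open>w t = (1 + 1/t)/2\<close> repairs this, since
  \<open>w (t + 1) / w t = 1 - 1/(t + 1)\<^sup>2\<close> is the factor of the weight inequality at \<open>x = 1/(t + 1)\<close>.
  The weights decrease, so that the differences of the nonnegative \<open>D\<close> can still be summed, and
  they stay in \<open>[1/2, 1]\<close>, so that only a factor \<open>2\<close> is lost.
\<close>

lemma weighted_recursion_bound:
  fixes \<delta> D :: "nat \<Rightarrow> real" and p k :: real
  assumes p: "0 < p" and k: "0 \<le> k"
    and \<delta>: "\<And>t. \<lbrakk>1 \<le> t; t \<le> T + 1\<rbrakk> \<Longrightarrow> 0 \<le> \<delta> t" and D: "\<And>t. \<lbrakk>1 \<le> t; t \<le> T + 1\<rbrakk> \<Longrightarrow> 0 \<le> D t"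
    and step: "\<And>t. \<lbrakk>1 \<le> t; t \<le> T\<rbrakk> \<Longrightarrow>
      real t powr p * \<delta> (t + 1) - real t powr p * (1 - p / real t) * \<delta> t \<le> D t - D (t + 1) + k / real t"
    and T: "1 \<le> T"
  shows "real T powr p * \<delta> (T + 1) \<le> 2 * (\<delta> 1 + D 1 + k * (ln (real T) + 1))"
proof -
  define w where "w = (\<lambda>t::nat. (1 + 1 / real t) / 2)"
  \<comment> \<open>At \<open>t = 1\<close> the coefficient of the initial gap is \<open>1 - p\<close>, positive for \<open>p < 1\<close>; hence the term \<open>\<delta> 1\<close>.\<close>
  have main: "w t * (real t powr p * \<delta> (t + 1) + D (t + 1)) \<le> \<delta> 1 + D 1 + k * harm t"
    if "1 \<le> t" "t \<le> T" for t
    using that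
  proof (induction t rule: dec_induct)
    case base
    have "\<delta> 2 \<le> (1 - p) * \<delta> 1 + D 1 - D 2 + k"
      using step[of 1] T by (simp add: numeral_2_eq_2)
    moreover have "(1 - p) * \<delta> 1 \<le> \<delta> 1"
      using \<delta>[of 1] p by (simp add: algebra_simps)
    ultimately show ?case by (simp add: w_def harm_def numeral_2_eq_2)
  next
    case (step t)
    let ?t = "Suc t"
    have t: "0 < real t" "t \<le> T" "?t \<le> T" using step.hyps step.prems by auto
    have w1: "0 \<le> w ?t" "w ?t \<le> 1" "w ?t \<le> w t"
      using t by (auto simp: w_def field_simps)
    have "real ?t powr p * \<delta> (?t + 1) + D (?t + 1)
        \<le> real ?t powr p * (1 - p / real ?t) * \<delta> ?t + D ?t + k / real ?t"
      using assms(5)[of ?t] t by (simp del: of_nat_Suc)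
    then have "w ?t * (real ?t powr p * \<delta> (?t + 1) + D (?t + 1))
        \<le> w ?t * (real ?t powr p * (1 - p / real ?t) * \<delta> ?t + D ?t + k / real ?t)"
      using w1 by (intro mult_left_mono) auto
    also have "\<dots> = (w ?t * (1 - p / real ?t) * real ?t powr p) * \<delta> ?t + w ?t * D ?t + w ?t * (k / real ?t)"
      by (simp add: algebra_simps del: of_nat_Suc)
    also have "\<dots> \<le> (w t * real t powr p) * \<delta> ?t + w t * D ?t + 1 * (k / real ?t)"
    proof (intro add_mono mult_right_mono)
      have "(1 - (1 / real ?t)\<^sup>2) * (1 - p * (1 / real ?t)) \<le> (1 - 1 / real ?t) powr p"
        using t p by (intro weight_inequality) auto
      also have "(1 - 1 / real ?t) powr p = real t powr p / real ?t powr p"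
        using t by (simp add: powr_divide[symmetric] field_simps)
      finally have "w t * real ?t powr p * ((1 - (1 / real ?t)\<^sup>2) * (1 - p * (1 / real ?t)))
          \<le> w t * real ?t powr p * (real t powr p / real ?t powr p)"
        by (rule mult_left_mono) (simp add: w_def)
      also have "\<dots> = w t * real t powr p" using t by simp
      finally have "(w t * (1 - (1 / real ?t)\<^sup>2)) * (1 - p / real ?t) * real ?t powr p
          \<le> w t * real t powr p"
        by (simp add: mult_ac del: of_nat_Suc)
      moreover have "w t * (1 - (1 / real ?t)\<^sup>2) = w ?t"
        using t by (simp add: w_def divide_simps power2_eq_square) (simp add: algebra_simps)
      ultimately show "w ?t * (1 - p / real ?t) * real ?t powr p \<le> w t * real t powr p"
        by simp
    qed (use w1 k t \<delta>[of ?t] D[of ?t] in \<open>auto\<close>)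
    also have "\<dots> \<le> \<delta> 1 + D 1 + k * harm ?t"
      using step.IH t by (simp add: harm_Suc algebra_simps inverse_eq_divide)
    finally show ?case by simp
  qed
  have "1 / 2 * (real T powr p * \<delta> (T + 1) + D (T + 1)) \<le> w T * (real T powr p * \<delta> (T + 1) + D (T + 1))"
    using \<delta>[of "T + 1"] D[of "T + 1"] by (intro mult_right_mono) (auto simp: w_def)
  moreover have "k * harm T \<le> k * (ln (real T) + 1)"
  proof (rule mult_left_mono[OF _ k])
    have "harm T - ln (real T) \<le> harm 1 - ln (real 1)"
      by (rule euler_mascheroni_sequence_decreasing) (use T in auto)
    then show "harm T \<le> ln (real T) + 1" by (simp add: harm_def)
  qed
  ultimately show ?thesis using main[OF T order_refl] D[of "T + 1"] by (simp add: field_simps)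
qed

section \<open>Growth of the objective around its minimiser\<close>

text \<open>
  The gradient vanishes at the minimiser, so the Bregman divergence from it is the gap itself.
\<close>

lemma gap_le_norm_powr:
  assumes "cont_diff d F" "star_convex_at d \<tau> F xs" "weakly_smooth d nrm L \<kappa> F" "x \<in> Rd d"
  shows "F x - F xs \<le> L / \<kappa> * nrm (x - xs) powr \<kappa>"
proof -
  have xs: "is_arg_min F (\<lambda>x. x \<in> Rd d) xs" "xs \<in> Rd d"
    using assms(2) by (auto simp: star_convex_at_def is_arg_min_def)
  have "dot (grad d F xs) (x - xs) = 0"
    by (rule grad_eq_0_at_argmin[OF assms(1) xs(1) diff_in_Rd[OF assms(4) xs(2)]])
  then have "F x - F xs = bregman d F x xs" by (simp add: bregman_def)
  also have "\<dots> \<le> L / \<kappa> * nrm (x - xs) powr \<kappa>"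
    using assms(3,4) xs(2) unfolding weakly_smooth_def by (meson abs_le_D1)
  finally show ?thesis .
qed

text \<open>
  Along the ray from the minimiser through \<open>x\<close>, star-convexity says that the gap \<open>\<phi>\<close> satisfies
  \<open>s \<phi>'(s) \<ge> \<phi>(s)/\<tau>\<close>, so \<open>\<phi>\<close> grows at least like \<open>s\<close> to the power \<open>1/\<tau>\<close>; weak smoothness allows
  at most growth like \<open>s\<^sup>\<kappa>\<close>. A value \<open>\<tau> < 1/\<kappa>\<close> is therefore only possible for constant \<open>F\<close>. This is
  what allows powers of \<open>\<tau>\<close> below \<open>q\<close> to be replaced by \<open>\<tau>\<^sup>q\<close>.
\<close>

lemma star_convexity_parameter_ge:
  assumes nrm: "norm_on_Rd d nrm" and F: "cont_diff d F" and star: "star_convex_at d \<tau> F xs"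
    and smooth: "weakly_smooth d nrm L \<kappa> F" and "0 < \<tau>" "x \<in> Rd d" "F xs < F x"
  shows "1 / \<tau> \<le> \<kappa>"
proof (rule ccontr)
  assume "\<not> 1 / \<tau> \<le> \<kappa>"
  define v where "v = x - xs"
  define \<phi> where "\<phi> = (\<lambda>s. F (xs + s *\<^sub>R v) - F xs)"
  have xs: "xs \<in> Rd d" using star by (simp add: star_convex_at_def is_arg_min_def)
  have v: "v \<in> Rd d" unfolding v_def using assms(6) xs by (rule diff_in_Rd)
  have line: "xs + s *\<^sub>R v \<in> Rd d" for s using xs v by (intro in_Rd)
  have grow: "\<phi> 1 \<le> \<phi> S * S powr (- 1 / \<tau>)" if "1 \<le> S" for S
  proof -
    have "\<phi> 1 * 1 powr (- 1 / \<tau>) \<le> \<phi> S * S powr (- 1 / \<tau>)"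
    proof (rule DERIV_nonneg_imp_nondecreasing[OF that])
      fix s :: real assume "1 \<le> s" "s \<le> S"
      let ?D = "dot (grad d F (xs + s *\<^sub>R v)) v"
      have "(\<phi> has_real_derivative ?D) (at s)"
        unfolding \<phi>_def by (auto intro!: derivative_eq_intros DERIV_along_line[OF F xs v])
      then have "((\<lambda>s. \<phi> s * s powr (- 1 / \<tau>)) has_real_derivative
          ?D * s powr (- 1 / \<tau>) + (- 1 / \<tau>) * s powr (- 1 / \<tau> - 1) * \<phi> s) (at s)"
        using \<open>1 \<le> s\<close> by (auto intro!: derivative_eq_intros)
      moreover have "?D * s powr (- 1 / \<tau>) + (- 1 / \<tau>) * s powr (- 1 / \<tau> - 1) * \<phi> s
          = s powr (- 1 / \<tau> - 1) * (s * ?D - \<phi> s / \<tau>)"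
        using \<open>1 \<le> s\<close> by (simp add: powr_diff field_simps)
      moreover have "0 \<le> s * ?D - \<phi> s / \<tau>"
      proof -
        have "F (xs + s *\<^sub>R v) - F xs \<le> \<tau> * dot (grad d F (xs + s *\<^sub>R v)) (xs + s *\<^sub>R v - xs)"
          using star line by (simp only: star_convex_at_def)
        then show ?thesis
          using \<open>0 < \<tau>\<close> by (simp add: \<phi>_def dot_simps field_simps)
      qed
      ultimately show "\<exists>y. ((\<lambda>s. \<phi> s * s powr (- 1 / \<tau>)) has_real_derivative y) (at s) \<and> 0 \<le> y"
        by (metis mult_nonneg_nonneg powr_ge_zero)
    qed
    then show ?thesis by simp
  qed
  define K where "K = L / \<kappa> * nrm v powr \<kappa>"
  have bound: "\<phi> 1 \<le> K * S powr (\<kappa> - 1 / \<tau>)" if "1 \<le> S" for S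
  proof -
    have "nrm (S *\<^sub>R v) = S * nrm v" "0 \<le> nrm v"
      using norm_on_Rd_scaleR[OF nrm v, of S] norm_on_Rd_nonneg[OF nrm v] that by auto
    then have "\<phi> S \<le> K * S powr \<kappa>"
      using gap_le_norm_powr[OF F star smooth line, of S] that
      by (simp add: \<phi>_def K_def powr_mult mult_ac)
    then have "\<phi> S * S powr (- 1 / \<tau>) \<le> K * S powr \<kappa> * S powr (- 1 / \<tau>)"
      by (rule mult_right_mono) simp
    then show ?thesis using grow[OF that] by (simp add: mult.assoc flip: powr_add)
  qed
  have "((\<lambda>S. K * S powr (\<kappa> - 1 / \<tau>)) \<longlongrightarrow> K * 0) at_top"
    using \<open>\<not> 1 / \<tau> \<le> \<kappa>\<close> by (intro tendsto_mult tendsto_const tendsto_neg_powr filterlim_ident) auto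
  then have "\<phi> 1 \<le> K * 0"
    by (rule tendsto_lowerbound) (use bound in \<open>auto intro: eventually_at_top_linorderI\<close>)
  then show False using assms(7) by (simp add: \<phi>_def v_def)
qed

text \<open>
  The gap is at most \<open>L/\<kappa> \<parallel>x - xs\<parallel>\<^sup>\<kappa>\<close>, and uniform convexity bounds \<open>\<parallel>x - xs\<parallel>\<^sup>q\<close> by the divergence.
  Young's inequality splits the resulting product into the two terms of the convergence rate.
\<close>

lemma initial_gap_bound:
  fixes q \<kappa> L \<mu> \<alpha> :: real
  assumes nrm: "norm_on_Rd d nrm" and F: "cont_diff d F" and star: "star_convex_at d \<tau> F xs"
    and smooth: "weakly_smooth d nrm L \<kappa> F" and convex: "unif_convex d nrm \<mu> q \<psi>"
    and pos: "0 < L" "0 < \<mu>" "0 < \<alpha>" "1 < \<kappa>" "\<kappa> < q" and x: "x \<in> Rd d"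
  shows "F x - F xs \<le> L * (bregman d \<psi> xs x / (\<alpha> * L) + (\<alpha> * L / \<mu>) powr (\<kappa> / (q - \<kappa>)))"
proof -
  let ?D = "bregman d \<psi> xs x" and ?w = "nrm (xs - x)"
  let ?V = "(\<alpha> * L / \<mu>) powr (\<kappa> / (q - \<kappa>))"
  have xs: "xs \<in> Rd d" using star by (simp add: star_convex_at_def is_arg_min_def)
  have w: "0 \<le> ?w" by (rule norm_on_Rd_nonneg[OF nrm diff_in_Rd[OF xs x]])
  have "nrm (x - xs) = ?w" by (rule norm_on_Rd_minus_commute[OF nrm x xs])
  then have "\<alpha> * (F x - F xs) \<le> \<alpha> * (L / \<kappa> * ?w powr \<kappa>)"
    using gap_le_norm_powr[OF F star smooth x] pos by (intro mult_left_mono) auto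
  also have "\<dots> \<le> \<mu> / q * ?w powr q
      + (q - \<kappa>) / (q * \<kappa>) * ((\<alpha> * L) powr (q / (q - \<kappa>)) / \<mu> powr (\<kappa> / (q - \<kappa>)))"
    using young_power_gap[of \<kappa> q "\<alpha> * L" \<mu> ?w] pos w by (simp add: mult_ac)
  also have "(\<alpha> * L) powr (q / (q - \<kappa>)) / \<mu> powr (\<kappa> / (q - \<kappa>)) = \<alpha> * L * ?V"
  proof -
    have "q / (q - \<kappa>) = 1 + \<kappa> / (q - \<kappa>)" using pos by (simp add: field_simps)
    then show ?thesis using pos by (simp add: powr_add powr_divide)
  qed
  also have "\<mu> / q * ?w powr q \<le> ?D" using convex xs x by (simp add: unif_convex_def)
  finally have 1: "\<alpha> * (F x - F xs) \<le> ?D + (q - \<kappa>) / (q * \<kappa>) * (\<alpha> * L * ?V)" by simp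
  have "(q - \<kappa>) / (q * \<kappa>) \<le> 1"
  proof -
    have "q * 1 \<le> q * \<kappa>" using pos by (intro mult_left_mono) auto
    then have "q - \<kappa> \<le> q * \<kappa>" using pos by linarith
    then show ?thesis using pos by simp
  qed
  then have "(q - \<kappa>) / (q * \<kappa>) * (\<alpha> * L * ?V) \<le> 1 * (\<alpha> * L * ?V)"
    using pos by (intro mult_right_mono) auto
  with 1 have "\<alpha> * (F x - F xs) \<le> ?D + \<alpha> * L * ?V" by simp
  then have "F x - F xs \<le> (?D + \<alpha> * L * ?V) / \<alpha>"
    using pos by (simp add: pos_le_divide_eq mult.commute)
  also have "\<dots> = L * (?D / (\<alpha> * L) + ?V)"
    using pos by (simp add: add_divide_distrib distrib_left)
  finally show ?thesis .
qed

section \<open>The parameter schedule and the rate\<close>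

text \<open>
  With \<open>s = t/(\<tau> p)\<close> the coefficient \<open>\<alpha>\<^sub>t s\<^sup>q\<close> of the new gap is a constant multiple of \<open>t\<^sup>p\<close>,
  the coefficient in the abstract recursion.
\<close>

lemma schedule_weight:
  fixes \<alpha> \<beta> \<kappa> q \<tau> p t :: real
  assumes "0 < t" "0 < \<tau>" "0 < p" "p = q - \<beta>"
  shows "(\<tau> * p) powr (q - \<kappa>) * (\<alpha> / t powr \<beta>) * (t / (\<tau> * p)) powr q
    = \<alpha> / (\<tau> * p) powr \<kappa> * t powr p"
proof -
  have "0 < \<tau> * p" using assms by simp
  then have "(\<tau> * p) powr (q - \<kappa>) * (\<alpha> / t powr \<beta>) * (t powr q / (\<tau> * p) powr q)
      = \<alpha> / (\<tau> * p) powr \<kappa> * (t powr q / t powr \<beta>)"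
    by (simp add: powr_diff)
  then show ?thesis using assms by (simp add: powr_divide powr_diff)
qed

text \<open>
  The exponent \<open>\<beta>\<close> is chosen for this identity: \<open>\<beta> q / (q - \<kappa>) = q + 1\<close>, so the error of iteration
  \<open>t\<close> is proportional to \<open>1/t\<close> and the errors sum up to a logarithm.
\<close>

lemma schedule_error:
  fixes \<alpha> \<beta> \<kappa> q B t L :: real
  assumes "0 < t" "0 < B" "0 < \<alpha>" "0 < L" "\<kappa> < q" "0 < q" "\<beta> = q - \<kappa> + (q - \<kappa>) / q"
  shows "(t / B) powr q * (B powr (q - \<kappa>) * (\<alpha> / t powr \<beta>) * L) powr (q / (q - \<kappa>))
    = (\<alpha> * L) powr (q / (q - \<kappa>)) / t"
proof -
  have "\<beta> * (q / (q - \<kappa>)) = q + 1"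
    using assms(5,6) unfolding assms(7) by (simp add: add_divide_distrib distrib_right)
  then have "(t powr \<beta>) powr (q / (q - \<kappa>)) = t powr q * t"
    using assms(1) by (simp add: powr_powr powr_add)
  moreover have "(B powr (q - \<kappa>)) powr (q / (q - \<kappa>)) = B powr q"
    using assms(5) by (simp add: powr_powr)
  ultimately have "(B powr (q - \<kappa>) * (\<alpha> / t powr \<beta>) * L) powr (q / (q - \<kappa>))
      = B powr q * (\<alpha> powr (q / (q - \<kappa>)) / (t powr q * t)) * L powr (q / (q - \<kappa>))"
    using assms(1-4) by (simp add: powr_mult powr_divide)
  then show ?thesis using assms(1-4) by (simp add: powr_mult powr_divide)
qed

text \<open>
  The parameters are given by equations, as \<open>qs\<close>, \<open>r\<close>, \<open>\<dots>\<close>, so that the proof can work with the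
  few identities that the recursion needs, and unfold the formulas only to derive these.
\<close>

lemma amd_convergence:
  fixes q \<kappa> \<tau> L \<mu> \<alpha> :: real and T :: nat
  assumes ranges: "2 \<le> q" "1 < \<kappa>" "\<kappa> \<le> 2" "\<kappa> < q"
    and nrm: "norm_on_Rd d nrm" and F: "cont_diff d F" and \<psi>: "cont_diff d \<psi>"
    and pos: "0 < \<tau>" "0 < L" "0 < \<mu>"
    and star: "star_convex_at d \<tau> F xs" and smooth: "weakly_smooth d nrm L \<kappa> F"
    and convex: "unif_convex d nrm \<mu> q \<psi>"
    and \<alpha>: "0 < \<alpha>" and T: "2 \<le> T"
    and qs: "qs = q / (q - 1)" and r: "r = (q - \<kappa>) / \<kappa>" and M: "M = (r / q) powr r"
    and \<beta>: "\<beta> = q - \<kappa> + (q - \<kappa>) / q"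
    and \<alpha>s: "\<alpha>s = (\<lambda>t::nat. (\<tau> * (q - \<beta>)) powr (q - \<kappa>) * (\<alpha> / real t powr \<beta>))"
    and \<eta>s: "\<eta>s = (\<lambda>t::nat. \<alpha>s t * (real t / (\<tau> * (q - \<beta>))) powr (q - 1))"
    and Cs: "Cs = (\<lambda>t::nat. (\<eta>s t / \<alpha>s t) powr (qs - 1) - 1 / \<tau>)"
    and \<epsilon>s: "\<epsilon>s = (\<lambda>t::nat. \<alpha> powr (q / (q - \<kappa>)) / (real t * \<eta>s t)
      * (M powr (1 / r) / \<mu> powr (1 / r)) * L powr (1 + 1 / r))"
    and run: "amd_run d nrm F \<psi> \<mu> q Cs \<epsilon>s \<alpha>s \<eta>s T x xag xmd lam"
  shows "F (xag (T + 1)) - F xs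
    \<le> 16 * 2 powr q * (L * \<tau> powr q / real T powr ((\<kappa> * q + \<kappa> - q) / q))
      * (bregman d \<psi> xs (x 1) / (\<alpha> * L)
         + (\<alpha> * L / \<mu>) powr (\<kappa> / (q - \<kappa>)) * ln (real T))"
proof -
  define p where "p = q - \<beta>"
  define B where "B = \<tau> * p"
  define A where "A = \<alpha> / B powr \<kappa>"
  \<comment> \<open>\<open>A t\<^sup>p\<close> is the coefficient of the gap, and \<open>K/t\<close> is both the search tolerance times
    \<open>\<eta>s t\<close> and the smoothness error of iteration \<open>t\<close>.\<close>
  define K where "K = (q - \<kappa>) / (q * \<kappa>) * ((\<alpha> * L) powr (q / (q - \<kappa>)) / \<mu> powr (\<kappa> / (q - \<kappa>)))"
  define U where "U = bregman d \<psi> xs (x 1) / (\<alpha> * L)"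
  define V where "V = (\<alpha> * L / \<mu>) powr (\<kappa> / (q - \<kappa>))"
  have q: "0 < q" "1 < q" using ranges by auto
  have p_eq: "p = (\<kappa> * q + \<kappa> - q) / q"
    using q by (simp add: p_def \<beta> field_simps)
  have "1 * q < \<kappa> * q" using ranges q by (intro mult_strict_right_mono) auto
  then have "0 < \<kappa> * q + \<kappa> - q" using ranges by linarith
  then have p: "0 < p" using q by (simp add: p_eq)
  have "0 \<le> (q - \<kappa>) / q" using ranges q by simp
  then have "p \<le> 2" using ranges unfolding p_def \<beta> by linarith
  have B: "0 < B" using p pos by (simp add: B_def)
  have A: "0 < A" using B \<alpha> by (simp add: A_def)
  have K: "0 \<le> K" using ranges q by (simp add: K_def)
  have xs: "xs \<in> Rd d" using star by (simp add: star_convex_at_def is_arg_min_def)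
  have mem: "x t \<in> Rd d \<and> xag t \<in> Rd d" if "1 \<le> t" "t \<le> T + 1" for t
  proof (cases "t = 1")
    case True
    then show ?thesis using run by (auto simp: amd_run_def)
  next
    case False
    then have "t - 1 \<in> {1..T}" "t = (t - 1) + 1" using that by auto
    then show ?thesis using run unfolding amd_run_def is_arg_min_def by metis
  qed
  have xmd: "xmd t \<in> Rd d" if "t \<in> {1..T}" for t
  proof -
    have "xmd t = lam t *\<^sub>R xag t + (1 - lam t) *\<^sub>R x t"
      using run that unfolding amd_run_def by blast
    then show ?thesis using mem[of t] that by (auto intro!: in_Rd)
  qed
  have D_nonneg: "0 \<le> bregman d \<psi> xs (x t)" if "1 \<le> t" "t \<le> T + 1" for t
  proof -
    have "\<mu> / q * nrm (xs - x t) powr q \<le> bregman d \<psi> xs (x t)"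
      using convex xs mem[OF that] unfolding unif_convex_def by blast
    moreover have "0 \<le> \<mu> / q * nrm (xs - x t) powr q" using pos q by simp
    ultimately show ?thesis by linarith
  qed
  have gap_nonneg: "0 \<le> F (xag t) - F xs" if "1 \<le> t" "t \<le> T + 1" for t
    using star mem[OF that] by (simp add: star_convex_at_def is_arg_min_linorder)

  have step: "real t powr p * (F (xag (t + 1)) - F xs)
        - real t powr p * (1 - p / real t) * (F (xag t) - F xs)
      \<le> bregman d \<psi> xs (x t) / A - bregman d \<psi> xs (x (t + 1)) / A + 2 * (K / A) / real t"
    if "1 \<le> t" "t \<le> T" for t
  proof -
    define s where "s = real t / B"
    have t: "t \<in> {1..T}" "0 < real t" using that by auto
    have s: "0 < s" using t B by (simp add: s_def)
    have a_eq: "\<alpha>s t = B powr (q - \<kappa>) * (\<alpha> / real t powr \<beta>)"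
      by (simp add: \<alpha>s B_def p_def)
    have a: "0 < \<alpha>s t" using t B \<alpha> by (simp add: a_eq)
    have h_eq: "\<eta>s t = \<alpha>s t * s powr (q - 1)" by (simp add: \<eta>s s_def B_def p_def)
    have h: "0 < \<eta>s t" using a s by (simp add: h_eq)
    \<comment> \<open>Conjugate exponents: the power \<open>qs - 1\<close> recovers \<open>s\<close> from \<open>\<eta>s t / \<alpha>s t = s\<^sup>q\<^sup>-\<^sup>1\<close>.\<close>
    have "(q - 1) * (qs - 1) = 1" using q by (simp add: qs field_simps)
    then have C_eq: "Cs t = s - 1 / \<tau>"
      using a s by (simp add: Cs h_eq powr_powr)
    have as: "\<alpha>s t * s powr q = A * real t powr p"
      unfolding a_eq s_def A_def B_def by (rule schedule_weight) (use t pos p p_def in auto)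
    have hs: "\<eta>s t * (s - 1 / \<tau>) = A * real t powr p * (1 - p / real t)"
    proof -
      have "\<eta>s t * (s - 1 / \<tau>) = \<alpha>s t * s powr q * (1 - 1 / (s * \<tau>))"
        using s by (simp add: h_eq powr_diff right_diff_distrib)
      also have "1 / (s * \<tau>) = p / real t" using pos by (simp add: s_def B_def)
      finally show ?thesis by (simp only: as)
    qed
    have h\<epsilon>: "\<eta>s t * \<epsilon>s t = K / real t"
    proof -
      have r_inv: "1 / r = \<kappa> / (q - \<kappa>)" by (simp add: r)
      have "0 < r" using ranges by (simp add: r)
      then have "M powr (1 / r) = (q - \<kappa>) / (q * \<kappa>)"
        using ranges q by (simp add: M powr_powr) (simp add: r)
      moreover have "1 + \<kappa> / (q - \<kappa>) = q / (q - \<kappa>)" using ranges by (simp add: field_simps)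
      ultimately show ?thesis
        using h pos \<alpha> by (simp add: \<epsilon>s r_inv K_def powr_mult mult_ac)
    qed
    have sE: "s powr q * ((q - \<kappa>) / (q * \<kappa>)
        * ((\<alpha>s t * L) powr (q / (q - \<kappa>)) / \<mu> powr (\<kappa> / (q - \<kappa>)))) = K / real t"
    proof -
      have "s powr q * (\<alpha>s t * L) powr (q / (q - \<kappa>)) = (\<alpha> * L) powr (q / (q - \<kappa>)) / real t"
        unfolding a_eq s_def by (rule schedule_error) (use t B \<alpha> pos ranges q \<beta> in auto)
      then have "(q - \<kappa>) / (q * \<kappa>) / \<mu> powr (\<kappa> / (q - \<kappa>))
            * (s powr q * (\<alpha>s t * L) powr (q / (q - \<kappa>)))
          = (q - \<kappa>) / (q * \<kappa>) / \<mu> powr (\<kappa> / (q - \<kappa>)) * ((\<alpha> * L) powr (q / (q - \<kappa>)) / real t)"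
        by (simp only:)
      then show ?thesis by (simp add: K_def mult_ac)
    qed
    have iter: "dot (grad d F (xmd t)) (xmd t - x t) + Cs t * (F (xmd t) - F (xag t)) \<le> \<epsilon>s t"
      "is_arg_min (\<lambda>y. \<eta>s t * dot (grad d F (xmd t)) y + bregman d \<psi> y (x t))
        (\<lambda>y. y \<in> Rd d) (x (t + 1))"
      "is_arg_min (\<lambda>y. \<alpha>s t * dot (grad d F (xmd t)) y + \<mu> / q * nrm (y - xmd t) powr q)
        (\<lambda>y. y \<in> Rd d) (xag (t + 1))"
      using run t(1) unfolding amd_run_def by blast+
    have xt: "x t \<in> Rd d" using mem that by simp
    have dist: "A * (X * a - X * c * b) = A * X * a - A * X * c * b" for X a b c :: real
      by (simp add: right_diff_distrib mult.assoc)
    from amd_one_step[OF nrm F \<psi> star smooth convex pos ranges(2,4) a s xt xmd[OF t(1)]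
        iter(1)[unfolded C_eq] iter(2)[unfolded h_eq] iter(3)]
    have "A * (real t powr p * (F (xag (t + 1)) - F xs)
          - real t powr p * (1 - p / real t) * (F (xag t) - F xs))
        \<le> (bregman d \<psi> xs (x t) - bregman d \<psi> xs (x (t + 1))) + 2 * K / real t"
      unfolding h_eq[symmetric] as hs h\<epsilon> sE dist by linarith
    then have "real t powr p * (F (xag (t + 1)) - F xs)
          - real t powr p * (1 - p / real t) * (F (xag t) - F xs)
        \<le> ((bregman d \<psi> xs (x t) - bregman d \<psi> xs (x (t + 1))) + 2 * K / real t) / A"
      using A by (simp only: pos_le_divide_eq mult.commute)
    then show ?thesis by (simp add: add_divide_distrib diff_divide_distrib mult.commute)
  qed
  have total: "real T powr p * (F (xag (T + 1)) - F xs)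
      \<le> 2 * ((F (xag 1) - F xs) + bregman d \<psi> xs (x 1) / A + 2 * (K / A) * (ln (real T) + 1))"
    by (rule weighted_recursion_bound[where D = "\<lambda>t. bregman d \<psi> xs (x t) / A"])
      (use p K A T D_nonneg gap_nonneg step in auto)

  \<comment> \<open>Since \<open>T \<ge> 2\<close>, constants can be absorbed into the logarithm.\<close>
  have "1 / 2 \<le> ln (2::real)" using ln2_ge_two_thirds by simp
  also have "ln (2::real) \<le> ln (real T)" using T by simp
  finally have lnT: "1 / 2 \<le> ln (real T)" .
  have U: "0 \<le> U" using D_nonneg[of 1] pos \<alpha> by (simp add: U_def)
  have V: "0 \<le> V" by (simp add: V_def)
  show ?thesis
  proof (cases "F (xag (T + 1)) = F xs")
    case True
    have "0 \<le> 16 * 2 powr q * (L * \<tau> powr q / real T powr p) * (U + V * ln (real T))"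
      using pos U V lnT by simp
    then show ?thesis using True by (simp add: U_def V_def p_eq)
  next
    case False
    \<comment> \<open>As \<open>2 \<tau> \<ge> 1\<close>, this one power dominates both \<open>(\<tau> p)\<^sup>\<kappa>\<close> and the factor \<open>1\<close> of the initial gap.\<close>
    define Z where "Z = (2 * \<tau>) powr q"
    have "1 / \<tau> \<le> \<kappa>"
      using gap_nonneg[of "T + 1"] False mem[of "T + 1"]
      by (intro star_convexity_parameter_ge[OF nrm F star smooth pos(1), of "xag (T + 1)"]) auto
    then have "1 / \<tau> \<le> 2" using ranges by simp
    then have \<tau>: "1 \<le> 2 * \<tau>" using pos by (simp add: field_simps)
    have Z: "1 \<le> Z" using \<tau> q by (simp add: Z_def ge_one_powr_ge_zero)
    have "B \<le> 2 * \<tau>" using \<open>p \<le> 2\<close> pos by (simp add: B_def)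
    then have "B powr \<kappa> \<le> (2 * \<tau>) powr \<kappa>" using B ranges by (intro powr_mono2) auto
    also have "\<dots> \<le> Z" unfolding Z_def using \<tau> ranges by (intro powr_mono) auto
    finally have BZ: "B powr \<kappa> \<le> Z" .
    have "F (xag 1) - F xs \<le> L * (U + V)"
      using initial_gap_bound[OF nrm F star smooth convex pos(2,3) \<alpha> ranges(2,4), of "x 1"] mem[of 1] run
      by (simp add: U_def V_def amd_run_def)
    also have "\<dots> \<le> Z * (L * (U + V))"
      using Z U V pos by (intro mult_right_mono[of 1 Z, simplified]) auto
    finally have gap1: "F (xag 1) - F xs \<le> Z * (L * (U + V))" .
    have "bregman d \<psi> xs (x 1) / A = B powr \<kappa> * (L * U)"
      using B \<alpha> pos by (simp add: A_def U_def)
    also have "\<dots> \<le> Z * (L * U)" using BZ pos U by (intro mult_right_mono) auto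
    finally have D1: "bregman d \<psi> xs (x 1) / A \<le> Z * (L * U)" .
    have "q / (q - \<kappa>) = 1 + \<kappa> / (q - \<kappa>)" using ranges by (simp add: field_simps)
    then have "K = (q - \<kappa>) / (q * \<kappa>) * (\<alpha> * L * V)"
      using pos \<alpha> by (simp add: K_def V_def powr_add powr_divide)
    also have "\<dots> \<le> 1 * (\<alpha> * L * V)"
    proof (rule mult_right_mono)
      have "q * 1 \<le> q * \<kappa>" using ranges q by (intro mult_left_mono) auto
      then have "q - \<kappa> \<le> q * \<kappa>" using ranges by linarith
      then show "(q - \<kappa>) / (q * \<kappa>) \<le> 1" using ranges q by simp
    qed (use pos \<alpha> V in simp)
    finally have "K / A \<le> \<alpha> * L * V / A" using A by (simp add: divide_right_mono)
    also have "\<dots> = B powr \<kappa> * (L * V)" using \<alpha> by (simp add: A_def)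
    also have "\<dots> \<le> Z * (L * V)" using BZ pos V by (intro mult_right_mono) auto
    finally have KA: "K / A \<le> Z * (L * V)" .
    have err: "2 * (K / A) * (ln (real T) + 1) \<le> 2 * (Z * (L * V)) * (3 * ln (real T))"
      using KA K A Z V pos lnT by (intro mult_mono) auto
    note total
    also have "2 * ((F (xag 1) - F xs) + bregman d \<psi> xs (x 1) / A + 2 * (K / A) * (ln (real T) + 1))
        \<le> 2 * (Z * (L * (U + V)) + Z * (L * U) + 2 * (Z * (L * V)) * (3 * ln (real T)))"
      by (intro mult_left_mono add_mono gap1 D1 err) simp
    also have "\<dots> = (Z * L) * (4 * U + 2 * V + 12 * (V * ln (real T)))" by (simp add: algebra_simps)
    also have "\<dots> \<le> (Z * L) * (16 * (U + V * ln (real T)))"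
    proof (rule mult_left_mono)
      have "V * (1 / 2) \<le> V * ln (real T)" using V lnT by (intro mult_left_mono) auto
      then show "4 * U + 2 * V + 12 * (V * ln (real T)) \<le> 16 * (U + V * ln (real T))"
        using U by simp
    qed (use Z pos in simp)
    finally have "F (xag (T + 1)) - F xs \<le> (Z * L) * (16 * (U + V * ln (real T))) / real T powr p"
      using T by (simp add: pos_le_divide_eq mult.commute)
    also have "\<dots> = 16 * 2 powr q * (L * \<tau> powr q / real T powr p) * (U + V * ln (real T))"
      using pos by (simp add: Z_def powr_mult)
    finally show ?thesis by (simp only: U_def V_def p_eq)
  qed
qed

theorem theorem3p1:
  fixes q \<kappa> :: real
  assumes "2 \<le> q" and "1 < \<kappa>" and "\<kappa> \<le> 2" and "\<kappa> < q"
  shows "\<exists>c>0. \<forall>(d::nat) (nrm :: rvec \<Rightarrow> real) (F :: rvec \<Rightarrow> real) (\<psi> :: rvec \<Rightarrow> real)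
            (\<tau>::real) (L::real) (\<mu>::real) (xs :: rvec) (\<alpha>::real) (T::nat)
            (x :: nat \<Rightarrow> rvec) (xag :: nat \<Rightarrow> rvec) (xmd :: nat \<Rightarrow> rvec) (lam :: nat \<Rightarrow> real).
       norm_on_Rd d nrm \<longrightarrow> cont_diff d F \<longrightarrow> cont_diff d \<psi> \<longrightarrow>
       0 < \<tau> \<longrightarrow> 0 < L \<longrightarrow> 0 < \<mu> \<longrightarrow>
       star_convex_at d \<tau> F xs \<longrightarrow>
       weakly_smooth d nrm L \<kappa> F \<longrightarrow>
       unif_convex d nrm \<mu> q \<psi> \<longrightarrow>
       0 < \<alpha> \<longrightarrow> 2 \<le> T \<longrightarrow>
       (let qs = q / (q - 1);
            r = (q - \<kappa>) / \<kappa>;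
            M = (r / q) powr r;
            \<beta> = q - \<kappa> + (q - \<kappa>) / q;
            \<alpha>s = (\<lambda>t::nat. (\<tau> * (q - \<beta>)) powr (q - \<kappa>) * (\<alpha> / real t powr \<beta>));
            \<eta>s = (\<lambda>t::nat. \<alpha>s t * (real t / (\<tau> * (q - \<beta>))) powr (q - 1));
            Cs = (\<lambda>t::nat. (\<eta>s t / \<alpha>s t) powr (qs - 1) - 1 / \<tau>);
            \<epsilon>s = (\<lambda>t::nat. \<alpha> powr (q / (q - \<kappa>)) / (real t * \<eta>s t)
                       * (M powr (1 / r) / \<mu> powr (1 / r)) * L powr (1 + 1 / r))
        in amd_run d nrm F \<psi> \<mu> q Cs \<epsilon>s \<alpha>s \<eta>s T x xag xmd lam \<longrightarrow>
           F (xag (T + 1)) - F xs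
             \<le> c * (L * \<tau> powr q / real T powr ((\<kappa> * q + \<kappa> - q) / q))
                 * (bregman d \<psi> xs (x 1) / (\<alpha> * L)
                    + (\<alpha> * L / \<mu>) powr (\<kappa> / (q - \<kappa>)) * ln (real T)))"
proof (intro exI[of _ "16 * 2 powr q"] conjI allI impI)
  show "0 < 16 * 2 powr q" by simp
qed (unfold Let_def, rule impI, rule amd_convergence[OF assms _ _ _ _ _ _ _ _ _ _ _ refl refl refl refl refl refl refl refl])

end
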